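(* Let $m,n$ be positive integers, $a,b$ non-negative integers with $a+b=n$, and $x,y$ complex numbers with $ax+by=0$. Define \[ R_{3,4}(x,y;m,n;\tau)= mn\sum_{\substack{r_1,\ldots,r_a,s_1,\ldots,s_b\in\mathbb{Z}\\ r_1+\cdots+r_a+s_1+\cdots+s_b=0}}(-1)^{s_1+\cdots+s_b}q^{r_1^2+\cdots+r_a^2+s_1^2+\cdots+s_b^2}e^{2i((r_1+\cdots+r_a)x+(s_1+\cdots+s_b)y)}. \] Let $S(z)=\sum_{k=0}^{mn-1}\vartheta_3^{a}\!\left(z+x+\tfrac{k\pi}{mn}\Big|\tau\right)\vartheta_4^{b}\!\left(z+y+\tfrac{k\pi}{mn}\Big|\tau\right)$. Then for all $z\in\mathbb{C}$: if $mb$ is even, $S(z)=R_{3,4}(x,y;m,n;\tau)\,\vartheta_3(mnz\,|\,m^2n\tau)$; if $mb$ is odd, $S(z)=R_{3,4}(x,y;m,n;\tau)\,\vartheta_4(mnz\,|\,m^2n\tau)$.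
   Context: Throughout, $\tau\in\mathbb{C}$ with $\Im(\tau)>0$ and $q=e^{\pi i\tau}$. The Jacobi theta functions are $\vartheta_3(z|\tau)=\sum_{n\in\mathbb{Z}}q^{n^2}e^{2niz}$ and $\vartheta_4(z|\tau)=\sum_{n\in\mathbb{Z}}(-1)^nq^{n^2}e^{2niz}$; $\vartheta_j(z|m^2n\tau)$ denotes the same function with $\tau$ replaced by $m^2n\tau$. A zeroth power equals $1$. *)

theory Defs
  imports "HOL-Analysis.Analysis"
begin

definition nome :: "complex \<Rightarrow> complex" where
  "nome \<tau> = exp (of_real pi * \<i> * \<tau>)"

definition theta3 :: "complex \<Rightarrow> complex \<Rightarrow> complex" where
  "theta3 z \<tau> = (\<Sum>\<^sub>\<infinity>n\<in>(UNIV :: int set).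
     nome \<tau> powi (n\<^sup>2) * exp (2 * of_int n * \<i> * z))"

definition theta4 :: "complex \<Rightarrow> complex \<Rightarrow> complex" where
  "theta4 z \<tau> = (\<Sum>\<^sub>\<infinity>n\<in>(UNIV :: int set).
     (-1) powi n * nome \<tau> powi (n\<^sup>2) * exp (2 * of_int n * \<i> * z))"

text \<open>
  Integer tuples \<open>(r\<^sub>1, \<dots>, r\<^sub>a)\<close> are functions on \<open>{1..a}\<close> in the extensional function
  space, so that distinct functions are distinct tuples; for \<open>a = 0\<close> there is exactly
  one, the empty tuple.
\<close>

definition zero_sum_tuples :: "nat \<Rightarrow> nat \<Rightarrow> ((nat \<Rightarrow> int) \<times> (nat \<Rightarrow> int)) set" where
  "zero_sum_tuples a b =
     {(r, s). r \<in> {1..a} \<rightarrow>\<^sub>E UNIV \<and> s \<in> {1..b} \<rightarrow>\<^sub>E UNIV \<and>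
              (\<Sum>j=1..a. r j) + (\<Sum>j=1..b. s j) = 0}"

definition R34 ::
  "nat \<Rightarrow> nat \<Rightarrow> complex \<Rightarrow> complex \<Rightarrow> nat \<Rightarrow> nat \<Rightarrow> complex \<Rightarrow> complex" where
  "R34 a b x y m n \<tau> = of_nat (m * n) *
     (\<Sum>\<^sub>\<infinity>(r, s)\<in>zero_sum_tuples a b.
        (-1) powi (\<Sum>j=1..b. s j) *
        nome \<tau> powi ((\<Sum>j=1..a. (r j)\<^sup>2) + (\<Sum>j=1..b. (s j)\<^sup>2)) *
        exp (2 * \<i> * (of_int (\<Sum>j=1..a. r j) * x + of_int (\<Sum>j=1..b. s j) * y)))"

definition S34 ::
  "nat \<Rightarrow> nat \<Rightarrow> complex \<Rightarrow> complex \<Rightarrow> nat \<Rightarrow> nat \<Rightarrow> complex \<Rightarrow> complex \<Rightarrow> complex" where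
  "S34 a b x y m n \<tau> z =
     (\<Sum>k<m * n. theta3 (z + x + of_nat k * of_real pi / of_nat (m * n)) \<tau> ^ a *
                 theta4 (z + y + of_nat k * of_real pi / of_nat (m * n)) \<tau> ^ b)"

end

theory Submission
  imports Defs
begin

text \<open>
  Expanding the powers turns every summand of \<open>S(z)\<close> into an absolutely convergent sum over
  pairs of tuples \<open>(r, s)\<close>. Summing over \<open>k\<close> is a sum over \<open>mn\<close>-th roots of unity, so it keeps,
  with factor \<open>mn\<close>, exactly the pairs whose total \<open>\<Sum>r + \<Sum>s\<close> is a multiple \<open>mnl\<close> of \<open>mn\<close>.
  Subtracting \<open>ml\<close> from each of the \<open>n\<close> entries makes the total \<open>0\<close>; because of the zero total
  and \<open>ax + by = 0\<close>, the shift only contributes the factor \<open>(-1)\<^bsup>mbl\<^esup> q\<^bsup>m\<^sup>2nl\<^sup>2\<^esup>\<close>, so the double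
  sum over \<open>l\<close> and the zero-sum pairs splits into a product.
\<close>

text \<open>The sign \<open>c\<close> makes both theta functions instances of one series, so the two
  parity cases can later be treated at once with \<open>c = (-1) ^ (m * b)\<close>.\<close>

definition theta_term :: "complex \<Rightarrow> complex \<Rightarrow> complex \<Rightarrow> int \<Rightarrow> complex" where
  "theta_term c \<tau> z n = c powi n * nome \<tau> powi n\<^sup>2 * exp (2 * of_int n * \<i> * z)"

lemma theta3_conv_theta_term: "theta3 z \<tau> = infsum (theta_term 1 \<tau> z) UNIV"
  by (simp add: theta3_def theta_term_def[abs_def])

lemma theta4_conv_theta_term: "theta4 z \<tau> = infsum (theta_term (-1) \<tau> z) UNIV"
  by (simp add: theta4_def theta_term_def[abs_def])

lemma nome_nonzero [simp]: "nome \<tau> \<noteq> 0"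
  by (simp add: nome_def)

section \<open>Absolute convergence of the theta series\<close>

lemma summable_on_exp_minus_abs_int: "(\<lambda>n::int. exp (- real_of_int \<bar>n\<bar>)) summable_on UNIV"
proof -
  let ?f = "\<lambda>n::int. exp (- real_of_int \<bar>n\<bar>)"
  have "summable (\<lambda>k. exp (-1::real) ^ k)"
    by (rule summable_geometric) simp
  hence s: "(\<lambda>k. exp (-1::real) ^ k) summable_on UNIV"
    by (intro norm_summable_imp_summable_on) simp
  have "?f summable_on range int"
    using s by (subst summable_on_reindex) (auto simp: o_def exp_of_nat_mult[symmetric])
  moreover have "?f summable_on range (\<lambda>k. - int k)"
    using s by (subst summable_on_reindex) (auto simp: o_def exp_of_nat_mult[symmetric] inj_def)
  \<comment> \<open>The two ranges share the point 0, which does no harm to summability on their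
    union.\<close>
  ultimately have "?f summable_on range int \<union> range (\<lambda>k. - int k)"
    by (rule summable_on_union)
  also have "range int \<union> range (\<lambda>k. - int k) = UNIV"
    by (auto simp: image_iff) (metis int_cases2)
  finally show ?thesis .
qed

lemma theta_term_abs_summable:
  assumes "Im \<tau> > 0" "norm c = 1"
  shows "(\<lambda>n. norm (theta_term c \<tau> z n)) summable_on UNIV"
proof (rule Infinite_Sum.abs_summable_on_comparison_test')
  define \<alpha> where "\<alpha> = pi * Im \<tau>"
  \<comment> \<open>The factor \<open>exp (2 * of_int n * \<i> * z)\<close> grows at most like
    \<open>exp (2 * \<bar>Im z\<bar> * \<bar>n\<bar>)\<close>; the extra 1 leaves
    \<open>exp (- \<bar>n\<bar>)\<close> over as a summable majorant.\<close>
  define \<beta> where "\<beta> = 2 * \<bar>Im z\<bar> + 1"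
  have \<alpha>: "\<alpha> > 0" using assms by (simp add: \<alpha>_def)
  show "(\<lambda>n::int. exp (\<beta>\<^sup>2 / (4 * \<alpha>)) * exp (- real_of_int \<bar>n\<bar>)) summable_on UNIV"
    by (intro summable_on_cmult_right summable_on_exp_minus_abs_int)
  fix n :: int
  have 1: "norm (nome \<tau> powi n\<^sup>2) = exp (- \<alpha> * (real_of_int n)\<^sup>2)"
    by (simp add: nome_def norm_power_int \<alpha>_def exp_power_int algebra_simps)
  have 2: "norm (exp (2 * of_int n * \<i> * z)) = exp (- 2 * of_int n * Im z)"
    by simp
  have "- of_int n * Im z \<le> \<bar>of_int n\<bar> * \<bar>Im z\<bar>"
    by (metis abs_ge_minus_self abs_mult minus_mult_left)
  \<comment> \<open>Completing the square bounds
    \<open>\<beta> * \<bar>n\<bar> - \<alpha> * n\<^sup>2\<close> by its maximum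
    \<open>\<beta>\<^sup>2 / (4 * \<alpha>)\<close>, the constant in the majorant.\<close>
  moreover have "0 \<le> (2 * \<alpha> * \<bar>of_int n\<bar> - \<beta>)\<^sup>2 / (4 * \<alpha>)"
    using \<alpha> by simp
  hence "0 \<le> \<alpha> * (real_of_int n)\<^sup>2 - \<beta> * \<bar>of_int n\<bar> + \<beta>\<^sup>2 / (4 * \<alpha>)"
    using \<alpha> by (simp add: field_simps power2_eq_square)
  ultimately have "- \<alpha> * (real_of_int n)\<^sup>2 + (- 2 * of_int n * Im z) \<le> \<beta>\<^sup>2 / (4 * \<alpha>) - \<bar>of_int n\<bar>"
    by (simp add: \<beta>_def algebra_simps)
  thus "norm (theta_term c \<tau> z n) \<le> exp (\<beta>\<^sup>2 / (4 * \<alpha>)) * exp (- real_of_int \<bar>n\<bar>)"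
    unfolding theta_term_def norm_mult 1 2
    by (simp add: assms norm_power_int flip: exp_add)
qed

section \<open>Products of series and sums over roots of unity\<close>

lemma has_sum_Times_mult:
  fixes f :: "'a \<Rightarrow> complex" and g :: "'b \<Rightarrow> complex"
  assumes f: "(\<lambda>x. norm (f x)) summable_on A" and g: "(\<lambda>y. norm (g y)) summable_on B"
  shows "((\<lambda>(x, y). f x * g y) has_sum (infsum f A * infsum g B)) (A \<times> B)"
proof -
  have "(\<lambda>p. norm (case p of (x, y) \<Rightarrow> f x * g y)) summable_on A \<times> B"
    unfolding Infinite_Sum.abs_summable_on_Sigma_iff
    using assms by (auto simp: norm_mult infsum_cmult_right' infsum_nonneg
         intro!: summable_on_cmult_right summable_on_cmult_left)
  hence s: "(\<lambda>(x, y). f x * g y) summable_on A \<times> B"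
    by (rule abs_summable_summable)
  have "infsum (\<lambda>(x, y). f x * g y) (A \<times> B) = infsum f A * infsum g B"
    using infsum_Sigma'_banach[OF s]
    by (simp add: infsum_cmult_right' infsum_cmult_left')
  with s show ?thesis
    by (metis has_sum_infsum)
qed

lemma abs_summable_power_PiE:
  fixes f :: "int \<Rightarrow> complex"
  assumes "(\<lambda>n. norm (f n)) summable_on UNIV"
  shows "(\<lambda>r. norm (\<Prod>j=1..a::nat. f (r j))) summable_on ({1..a} \<rightarrow>\<^sub>E UNIV)"
  using assms abs_summable_on_prod_PiE[of "{1..a}" "\<lambda>_. UNIV" "\<lambda>_. f"]
  by (simp add: abs_summable_equivalent)

text \<open>This expands a power of a theta function over tuples. For \<open>a = 0\<close> the
  single empty tuple with its empty product matches the zeroth power 1.\<close>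

lemma infsum_power_PiE:
  fixes f :: "int \<Rightarrow> complex"
  assumes "(\<lambda>n. norm (f n)) summable_on UNIV"
  shows "infsum (\<lambda>r. \<Prod>j=1..a::nat. f (r j)) ({1..a} \<rightarrow>\<^sub>E UNIV) = infsum f UNIV ^ a"
  using infsum_prod_PiE_abs[of "{1..a}" "\<lambda>_. f" "\<lambda>_. UNIV"] assms by simp

lemma prod_theta_term:
  assumes "c \<noteq> 0"
  shows "(\<Prod>j\<in>A. theta_term c \<tau> z (r j)) =
    c powi (\<Sum>j\<in>A. r j) * nome \<tau> powi (\<Sum>j\<in>A. (r j)\<^sup>2) * exp (2 * of_int (\<Sum>j\<in>A. r j) * \<i> * z)"
  by (induction A rule: infinite_finite_induct)
     (auto simp: theta_term_def power_int_add assms exp_add algebra_simps)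

text \<open>The summands are the powers of \<open>w = exp (2 * \<i> * t * pi / N)\<close>, and
  \<open>w ^ N = 1\<close>. Hence the geometric sum vanishes unless \<open>w = 1\<close>, which
  happens exactly when \<open>N\<close> divides \<open>t\<close>.\<close>

lemma sum_exp_roots_of_unity:
  fixes t :: int
  assumes "N > 0"
  shows "(\<Sum>k<N. exp (2 * \<i> * of_int t * (of_nat k * of_real pi / of_nat N))) =
    (if int N dvd t then of_nat N else (0::complex))"
proof -
  define w where "w = exp (2 * \<i> * of_int t * (of_real pi / of_nat N))"
  have *: "exp (2 * \<i> * of_int t * (of_nat k * of_real pi / of_nat N)) = w ^ k" for k
    unfolding w_def exp_of_nat_mult[symmetric] by (simp add: mult_ac)
  have "w ^ N = exp (of_int t * (2 * of_real pi * \<i>))"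
    using assms unfolding w_def exp_of_nat_mult[symmetric] by (simp add: mult_ac)
  also have "\<dots> = 1"
    by (subst exp_eq_1) auto
  finally have wN: "w ^ N = 1" .
  have "w = 1 \<longleftrightarrow> (\<exists>l::int. 2 * t * (pi / N) = of_int (2 * l) * pi)"
    unfolding w_def by (subst exp_eq_1) (simp add: Im_divide power2_eq_square mult.assoc)
  also have "\<dots> \<longleftrightarrow> (\<exists>l::int. real_of_int t = real_of_int (int N * l))"
    using assms by (simp add: field_simps)
  also have "\<dots> \<longleftrightarrow> int N dvd t"
    unfolding of_int_eq_iff by (auto simp: dvd_def)
  finally have w1: "w = 1 \<longleftrightarrow> int N dvd t" .
  show ?thesis
  proof (cases "w = 1")
    case True
    with w1 show ?thesis unfolding * by simp
  next
    case False
    with w1 wN show ?thesis unfolding * by (simp add: geometric_sum)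
  qed
qed

lemma has_sum_sum:
  fixes f :: "'i \<Rightarrow> 'a \<Rightarrow> 'b :: topological_comm_monoid_add"
  assumes "\<And>i. i \<in> I \<Longrightarrow> (f i has_sum S i) A"
  shows "((\<lambda>x. \<Sum>i\<in>I. f i x) has_sum (\<Sum>i\<in>I. S i)) A"
  using assms by (induction I rule: infinite_finite_induct) (auto intro: has_sum_add)

section \<open>Pairs of tuples and the diagonal shift\<close>

context
  fixes a b :: nat and x y \<tau> :: complex
begin

definition tuples :: "((nat \<Rightarrow> int) \<times> (nat \<Rightarrow> int)) set" where
  "tuples = ({1..a} \<rightarrow>\<^sub>E UNIV) \<times> ({1..b} \<rightarrow>\<^sub>E UNIV)"

definition tuple_sum :: "(nat \<Rightarrow> int) \<times> (nat \<Rightarrow> int) \<Rightarrow> int" where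
  "tuple_sum = (\<lambda>(r, s). (\<Sum>j=1..a. r j) + (\<Sum>j=1..b. s j))"

text \<open>The summand of \<open>R34\<close>, taken on all pairs of tuples, since the filter by
  roots of unity starts from the unrestricted sum.\<close>

definition tuple_term :: "(nat \<Rightarrow> int) \<times> (nat \<Rightarrow> int) \<Rightarrow> complex" where
  "tuple_term = (\<lambda>(r, s). (-1) powi (\<Sum>j=1..b. s j) *
        nome \<tau> powi ((\<Sum>j=1..a. (r j)\<^sup>2) + (\<Sum>j=1..b. (s j)\<^sup>2)) *
        exp (2 * \<i> * (of_int (\<Sum>j=1..a. r j) * x + of_int (\<Sum>j=1..b. s j) * y)))"

text \<open>The restrictions keep shifted tuples extensional; otherwise the shift would change the
  values outside the index ranges and leave \<open>tuples\<close>.\<close>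

definition tuple_shift :: "int \<Rightarrow> (nat \<Rightarrow> int) \<times> (nat \<Rightarrow> int) \<Rightarrow> (nat \<Rightarrow> int) \<times> (nat \<Rightarrow> int)" where
  "tuple_shift d = (\<lambda>(r, s). (\<lambda>j\<in>{1..a}. r j + d, \<lambda>j\<in>{1..b}. s j + d))"

lemma zero_sum_tuples_eq: "zero_sum_tuples a b = {p \<in> tuples. tuple_sum p = 0}"
  by (auto simp: zero_sum_tuples_def tuples_def tuple_sum_def)

lemma tuple_shift_in_tuples: "tuple_shift d p \<in> tuples"
  by (auto simp: tuples_def tuple_shift_def split: prod.splits)

lemma tuple_sum_shift: "tuple_sum (tuple_shift d p) = tuple_sum p + int (a + b) * d"
  by (simp add: tuple_sum_def tuple_shift_def sum.distrib algebra_simps split: prod.splits)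

lemma tuple_shift_shift: "tuple_shift d (tuple_shift e p) = tuple_shift (d + e) p"
  by (auto simp: tuple_shift_def fun_eq_iff restrict_def split: prod.splits)

lemma tuple_shift_0: "p \<in> tuples \<Longrightarrow> tuple_shift 0 p = p"
  by (auto simp: tuple_shift_def tuples_def PiE_restrict)

text \<open>In the sum of squares the cross term is \<open>2 * d\<close> times the total, hence 0;
  the argument of the exponential changes by a multiple of \<open>d * (a * x + b * y)\<close>, hence
  not at all.\<close>

lemma tuple_term_shift:
  assumes "of_nat a * x + of_nat b * y = 0" and "tuple_sum p = 0"
  shows "tuple_term (tuple_shift d p) =
    (-1) powi (int b * d) * nome \<tau> powi (int (a + b) * d\<^sup>2) * tuple_term p"
proof -
  obtain r s where p: "p = (r, s)" by force
  let ?R = "\<Sum>j=1..a. r j" and ?S = "\<Sum>j=1..b. s j"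
  have RS: "?R + ?S = 0" using assms(2) by (simp add: tuple_sum_def p)
  have "(\<Sum>j=1..a. (r j + d)\<^sup>2) + (\<Sum>j=1..b. (s j + d)\<^sup>2) =
      (\<Sum>j=1..a. (r j)\<^sup>2) + (\<Sum>j=1..b. (s j)\<^sup>2) + 2 * d * (?R + ?S) + int (a + b) * d\<^sup>2"
    by (simp add: power2_sum sum.distrib sum_distrib_left algebra_simps)
  hence sq: "(\<Sum>j=1..a. (r j + d)\<^sup>2) + (\<Sum>j=1..b. (s j + d)\<^sup>2) =
      int (a + b) * d\<^sup>2 + ((\<Sum>j=1..a. (r j)\<^sup>2) + (\<Sum>j=1..b. (s j)\<^sup>2))"
    using RS by simp
  have sR: "(\<Sum>j=1..a. r j + d) = ?R + int a * d" and sS: "(\<Sum>j=1..b. s j + d) = int b * d + ?S"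
    by (simp_all add: sum.distrib)
  have "of_int (?R + int a * d) * x + of_int (int b * d + ?S) * y =
      of_int ?R * x + of_int ?S * y + of_int d * (of_nat a * x + of_nat b * y)"
    by (simp add: algebra_simps)
  hence ex: "of_int (?R + int a * d) * x + of_int (int b * d + ?S) * y = of_int ?R * x + of_int ?S * y"
    using assms(1) by simp
  show ?thesis
    unfolding p tuple_term_def tuple_shift_def prod.case
    by (simp only: sum.cong[OF refl restrict_apply'] restrict_apply' cong: sum.cong)
       (simp only: sq sR sS ex power_int_add[OF disjI1[OF nome_nonzero]]
          power_int_add[OF disjI1, of "-1 :: complex"] neg_equal_0_iff_equal one_neq_zero not_False_eq_True,
        simp only: mult_ac)
qed

text \<open>With \<open>N = m * (a + b)\<close>, shifting a zero-sum pair by \<open>m * l\<close>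
  gives it the total \<open>l * N\<close>. So the quotient of the total by \<open>N\<close> recovers
  \<open>l\<close>, and the opposite shift recovers the pair.\<close>

lemma bij_betw_tuple_shift:
  assumes "a + b > 0" "m > 0"
  shows "bij_betw (\<lambda>(l, p). tuple_shift (int m * l) p) (UNIV \<times> zero_sum_tuples a b)
           {p \<in> tuples. int (m * (a + b)) dvd tuple_sum p}"
proof (rule bij_betw_byWitness)
  let ?N = "int (m * (a + b))"
  let ?f = "\<lambda>(l, p). tuple_shift (int m * l) p"
  let ?g = "\<lambda>p. (tuple_sum p div ?N, tuple_shift (- (int m * (tuple_sum p div ?N))) p)"
  \<comment> \<open>Positivity of \<open>a + b\<close> and \<open>m\<close> makes \<open>?N\<close>
    nonzero, so that dividing \<open>l * ?N\<close> by \<open>?N\<close> returns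
    \<open>l\<close>.\<close>
  have N: "int (a + b) * (int m * l) = l * ?N" "?N \<noteq> 0" for l
    using assms by auto
  show "\<forall>q\<in>UNIV \<times> zero_sum_tuples a b. ?g (?f q) = q"
    using N(2) by (auto simp: zero_sum_tuples_eq tuple_sum_shift tuple_shift_shift tuple_shift_0 N(1)
      simp del: of_nat_mult of_nat_add)
  show "\<forall>p\<in>{p \<in> tuples. ?N dvd tuple_sum p}. ?f (?g p) = p"
    by (auto simp: tuple_shift_shift tuple_shift_0)
  show "?f ` (UNIV \<times> zero_sum_tuples a b) \<subseteq> {p \<in> tuples. ?N dvd tuple_sum p}"
    by (auto simp: zero_sum_tuples_eq tuple_sum_shift tuple_shift_in_tuples N(1)
      simp del: of_nat_mult of_nat_add)
  show "?g ` {p \<in> tuples. ?N dvd tuple_sum p} \<subseteq> UNIV \<times> zero_sum_tuples a b"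
    by (auto simp: zero_sum_tuples_eq tuple_sum_shift tuple_shift_in_tuples N(1)
      simp del: of_nat_mult of_nat_add)
qed

text \<open>The common part \<open>w\<close> of both arguments couples only to the total of the
  pair, while \<open>x\<close> and \<open>y\<close> stay inside \<open>tuple_term\<close>. Putting
  \<open>k * pi / N\<close> into \<open>w\<close> therefore yields roots of unity indexed by the
  total.\<close>

lemma has_sum_theta_product:
  assumes "Im \<tau> > 0"
  shows "((\<lambda>p. tuple_term p * exp (2 * \<i> * of_int (tuple_sum p) * w)) has_sum
     (theta3 (w + x) \<tau> ^ a * theta4 (w + y) \<tau> ^ b)) tuples"
proof -
  note t = theta_term_abs_summable[OF assms]
  let ?f = "theta_term 1 \<tau> (w + x)" and ?g = "theta_term (-1) \<tau> (w + y)"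
  have "((\<lambda>(r, s). (\<Prod>j=1..a. ?f (r j)) * (\<Prod>j=1..b. ?g (s j))) has_sum
     (theta3 (w + x) \<tau> ^ a * theta4 (w + y) \<tau> ^ b)) tuples"
    unfolding theta3_conv_theta_term theta4_conv_theta_term tuples_def
    by (subst (1 2) infsum_power_PiE[symmetric])
       (intro t has_sum_Times_mult abs_summable_power_PiE; simp)+
  also have "(\<lambda>(r, s). (\<Prod>j=1..a. ?f (r j)) * (\<Prod>j=1..b. ?g (s j))) =
     (\<lambda>p. tuple_term p * exp (2 * \<i> * of_int (tuple_sum p) * w))"
    by (auto simp: fun_eq_iff prod_theta_term tuple_term_def tuple_sum_def power_int_add
          exp_add algebra_simps simp del: of_int_sum)
  finally show ?thesis .
qed

lemma S34_eq_theta_term: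
  assumes "Im \<tau> > 0" "m > 0" "n > 0" "a + b = n" and xy: "of_nat a * x + of_nat b * y = 0"
  shows "S34 a b x y m n \<tau> z = R34 a b x y m n \<tau> *
    infsum (theta_term ((-1) ^ (m * b)) (of_nat (m\<^sup>2 * n) * \<tau>) (of_nat (m * n) * z)) UNIV"
proof -
  define N where "N = m * n"
  have N: "N > 0" using assms by (simp add: N_def)
  define g where "g = theta_term ((-1) ^ (m * b)) (of_nat (m\<^sup>2 * n) * \<tau>) (of_nat N * z)"
  let ?D = "{p \<in> tuples. int N dvd tuple_sum p}"
  let ?h = "\<lambda>p. tuple_term p * exp (2 * \<i> * of_int (tuple_sum p) * z)"
  let ?S = "S34 a b x y m n \<tau> z"
  let ?Z = "(UNIV :: int set) \<times> zero_sum_tuples a b"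
  let ?w = "\<lambda>k. z + of_nat k * of_real pi / of_nat N"
  have "((\<lambda>p. \<Sum>k<N. tuple_term p * exp (2 * \<i> * of_int (tuple_sum p) * ?w k)) has_sum
    (\<Sum>k<N. theta3 (?w k + x) \<tau> ^ a * theta4 (?w k + y) \<tau> ^ b)) tuples"
    by (intro has_sum_sum has_sum_theta_product assms)
  also have "(\<Sum>k<N. theta3 (?w k + x) \<tau> ^ a * theta4 (?w k + y) \<tau> ^ b) = ?S"
    by (simp only: S34_def N_def add_ac)
  also have "(\<lambda>p. \<Sum>k<N. tuple_term p * exp (2 * \<i> * of_int (tuple_sum p) * ?w k)) =
     (\<lambda>p. ?h p * (if int N dvd tuple_sum p then of_nat N else 0))"
    unfolding sum_exp_roots_of_unity[OF N, symmetric] sum_distrib_left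
    by (simp add: ring_distribs exp_add mult.assoc)
  finally have "((\<lambda>p. ?h p * (if int N dvd tuple_sum p then of_nat N else 0)) has_sum ?S) tuples" .
  \<comment> \<open>Pairs outside \<open>?D\<close> carry the coefficient 0.\<close>
  also have "?this \<longleftrightarrow> ((\<lambda>p. of_nat N * ?h p) has_sum ?S) ?D"
    by (rule has_sum_cong_neutral) auto
  also have "\<dots> \<longleftrightarrow> ((\<lambda>q. of_nat N * ?h (case q of (l, p) \<Rightarrow> tuple_shift (int m * l) p)) has_sum ?S)
      ?Z"
    using bij_betw_tuple_shift[of m] assms
    by (intro has_sum_reindex_bij_betw[symmetric]) (simp add: N_def)
  \<comment> \<open>The shifted pair has total \<open>N * l\<close>, giving the exponential of the
    theta series at \<open>N * z\<close>. The nome exponent \<open>n * (m * l)\<^sup>2\<close> is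
    \<open>m\<^sup>2 * n * l\<^sup>2\<close>, which means nome parameter
    \<open>m\<^sup>2 * n * \<tau>\<close>.\<close>
  also have "\<dots> \<longleftrightarrow> ((\<lambda>(l, p). g l * (of_nat N * tuple_term p)) has_sum ?S) ?Z"
  proof (rule has_sum_cong)
    fix q assume "q \<in> (UNIV :: int set) \<times> zero_sum_tuples a b"
    then obtain l p where q: "q = (l, p)" and p: "tuple_sum p = 0"
      by (auto simp: zero_sum_tuples_eq)
    have nome: "nome (of_nat (m\<^sup>2 * n) * \<tau>) = nome \<tau> powi int (m\<^sup>2 * n)"
      unfolding nome_def power_int_of_nat exp_of_nat_mult[symmetric] by (simp add: mult_ac)
    have sgn: "(-1 :: complex) ^ (m * b) = (-1) powi int (m * b)"
      by (rule power_int_of_nat[symmetric])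
    show "of_nat N * ?h (case q of (l, p) \<Rightarrow> tuple_shift (int m * l) p) =
       (case q of (l, p) \<Rightarrow> g l * (of_nat N * tuple_term p))"
      unfolding q prod.case tuple_term_shift[OF xy p] tuple_sum_shift p g_def theta_term_def nome sgn
        power_int_mult[symmetric]
      using assms(4) by (simp add: power_mult_distrib N_def mult_ac)
  qed
  finally have hs: "((\<lambda>(l, p). g l * (of_nat N * tuple_term p)) has_sum ?S) ?Z" .
  have "?S = infsum (\<lambda>(l, p). g l * (of_nat N * tuple_term p)) ?Z"
    using infsumI[OF hs] ..
  also have "\<dots> = (\<Sum>\<^sub>\<infinity>l. \<Sum>\<^sub>\<infinity>p\<in>zero_sum_tuples a b. g l * (of_nat N * tuple_term p))"
    using infsum_Sigma'_banach[OF has_sum_imp_summable[OF hs]] by simp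
  \<comment> \<open>Constant factors leave an infinite sum over a field unconditionally, so the
    series in \<open>R34\<close> raises no separate convergence obligation.\<close>
  also have "\<dots> = infsum g UNIV * R34 a b x y m n \<tau>"
    by (simp add: infsum_cmult_left' infsum_cmult_right' R34_def N_def tuple_term_def)
  finally show ?thesis
    by (simp add: g_def N_def)
qed

end

theorem theorem3p14:
  fixes m n a b :: nat and x y \<tau> :: complex
  assumes "Im \<tau> > 0"
    and "m > 0" and "n > 0"
    and "a + b = n"
    and "of_nat a * x + of_nat b * y = 0"
  shows "\<forall>z :: complex.
    (even (m * b) \<longrightarrow>
       S34 a b x y m n \<tau> z =
         R34 a b x y m n \<tau> * theta3 (of_nat (m * n) * z) (of_nat (m\<^sup>2 * n) * \<tau>)) \<and>
    (odd (m * b) \<longrightarrow>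
       S34 a b x y m n \<tau> z =
         R34 a b x y m n \<tau> * theta4 (of_nat (m * n) * z) (of_nat (m\<^sup>2 * n) * \<tau>))"
  using S34_eq_theta_term[OF assms]
  by (simp only: theta3_conv_theta_term theta4_conv_theta_term) simp

end
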